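(* Let $F\colon\mathbb{B}^{2L}\to\mathbb{B}^{2L}$ be the Boolean Delta-Notch system over a graph $\mathcal{G}$ as in the context. For every $x\in\mathbb{B}^{2L}$ that is not a fixed point of $F$, there is a path in the asynchronous dynamics $AD_F$ from $x$ to a fixed point of $F$.
   Context: Let $L\ge 1$ and let $\mathcal{G}$ be an undirected connected graph without loops on the vertex set $C=\{1,\dots,L\}$. For $i\in C$ let $S(i)$ be the set of neighbours of $i$ in $\mathcal{G}$. $\mathbb{B}=\{0,1\}$. States of $\mathbb{B}^{2L}$ are written $(n,d)=(n_1,\dots,n_L,d_1,\dots,d_L)$. The Boolean Delta-Notch system is $F\colon\mathbb{B}^{2L}\to\mathbb{B}^{2L}$ with $F_i(n,d)=\bigvee_{j\in S(i)}d_j$ (empty disjunction $=0$) and $F_{i+L}(n,d)=1-n_i$ for $i\in C$. For a map $f\colon\mathbb{B}^m\to\mathbb{B}^m$, the asynchronous dynamics $AD_f$ is the directed graph on $\mathbb{B}^m$ with an edge from $x$ to the state obtained from $x$ by flipping coordinate $i$ whenever $f_i(x)\neq x_i$. A fixed point is $x$ with $f(x)=x$. *)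

theory Defs
  imports "Graph_Theory.Graph_Theory" "HOL-Library.FuncSet"
begin

text \<open>
  \<open>\<bool>\<close> is the type \<^typ>\<open>bool\<close>, and a state in \<open>\<bool>\<^sup>m\<close> is a function with coordinates indexed by
  \<open>1, \<dots>, m\<close>, extensional so that two states are equal iff all their coordinates are.
\<close>
definition cube :: "nat \<Rightarrow> (nat \<Rightarrow> bool) set" where
  "cube m = {1..m} \<rightarrow>\<^sub>E UNIV"

definition AD :: "nat \<Rightarrow> ((nat \<Rightarrow> bool) \<Rightarrow> nat \<Rightarrow> bool) \<Rightarrow> (nat \<Rightarrow> bool) pair_pre_digraph" where
  "AD m f = \<lparr>pverts = cube m,
     parcs = {(x, x(i := \<not> x i)) | x i. x \<in> cube m \<and> i \<in> {1..m} \<and> f x i \<noteq> x i}\<rparr>"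

text \<open>An undirected graph is a symmetric digraph, so the neighbours are the heads of outgoing arcs.\<close>
definition neighbours :: "'a pair_pre_digraph \<Rightarrow> 'a \<Rightarrow> 'a set" where
  "neighbours G i = {j. (i, j) \<in> parcs G}"

text \<open>In a state \<open>x = (n, d)\<close>, the coordinate \<open>n\<^sub>i\<close> is \<open>x i\<close> and \<open>d\<^sub>i\<close> is \<open>x (i + L)\<close>.\<close>
definition delta_notch ::
  "nat \<Rightarrow> nat pair_pre_digraph \<Rightarrow> (nat \<Rightarrow> bool) \<Rightarrow> nat \<Rightarrow> bool" where
  "delta_notch L G x = (\<lambda>k\<in>{1..2 * L}.
     if k \<le> L then \<exists>j\<in>neighbours G k. x (j + L) else \<not> x (k - L))"

end

theory Submission
  imports Defs
begin

text \<open>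
  Coordinates that do not influence each other can be updated one after the other as if
  simultaneously. Updating all \<open>d\<^sub>i\<close> leads to a state with \<open>d = 1 - n\<close>, which is encoded by the set
  \<open>D = {i. d\<^sub>i = 1}\<close> and is a fixed point iff \<open>D\<close> is a maximal independent set of the graph, that
  is, a kernel of the symmetric digraph. Choose a maximal independent subset \<open>I\<close> of \<open>D\<close> and extend
  it to a maximal independent set \<open>K\<close> of the graph. Every cell of \<open>D - I\<close> has a neighbour in \<open>I\<close>,
  and no cell of \<open>K - I\<close> has one, so updating first the \<open>n\<^sub>i\<close> with \<open>i \<in> D - I\<close>, then all \<open>d\<^sub>i\<close>,
  then the \<open>n\<^sub>i\<close> with \<open>i \<in> K - I\<close>, and finally all \<open>d\<^sub>i\<close> turns \<open>D\<close> into \<open>I\<close> and \<open>I\<close> into \<open>K\<close>.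
\<close>

lemma fun_upd_in_cube: "x \<in> cube m \<Longrightarrow> i \<in> {1..m} \<Longrightarrow> x(i := b) \<in> cube m"
  by (auto simp: cube_def PiE_def extensional_def)

lemma wf_digraph_AD: "wf_digraph (AD m f)"
proof -
  have "pair_wf_digraph (AD m f)"
    by unfold_locales (auto simp: AD_def fun_upd_in_cube)
  then show ?thesis
    by (simp add: wf_digraph_wp_iff)
qed

lemma reachable_AD_refl: "x \<in> cube m \<Longrightarrow> x \<rightarrow>\<^sup>*\<^bsub>AD m f\<^esub> x"
  by (rule wf_digraph.reachable_refl[OF wf_digraph_AD]) (simp add: AD_def)

lemmas reachable_AD_trans [trans] = wf_digraph.reachable_trans[OF wf_digraph_AD]

lemma reachable_AD_in_cube:
  assumes "x \<rightarrow>\<^sup>*\<^bsub>AD m f\<^esub> y"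
  shows "y \<in> cube m"
  using wf_digraph.reachable_in_verts(2)[OF wf_digraph_AD assms] by (simp add: AD_def)

lemma reachable_AD_fun_upd:
  assumes "x \<in> cube m" and "i \<in> {1..m}"
  shows "x \<rightarrow>\<^sup>*\<^bsub>AD m f\<^esub> x(i := f x i)"
proof (cases "f x i = x i")
  case True
  then show ?thesis
    using reachable_AD_refl[OF assms(1)] by (simp add: fun_upd_idem)
next
  case False
  then have "f x i = (\<not> x i)" by blast
  then show ?thesis
    using assms by (intro wf_digraph.reachable_adjI[OF wf_digraph_AD]) (auto simp: AD_def)
qed

lemma reachable_AD_override_on:
  assumes in_cube: "x \<in> cube m" and subset: "A \<subseteq> {1..m}"
    and no_influence: "\<And>y i. i \<in> A \<Longrightarrow> (\<And>k. k \<notin> A \<Longrightarrow> y k = x k) \<Longrightarrow> f y i = f x i"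
  shows "x \<rightarrow>\<^sup>*\<^bsub>AD m f\<^esub> override_on x (f x) A"
proof -
  have "finite A"
    using subset finite_subset by blast
  then show ?thesis
    using subset_refl
  proof (induction rule: finite_subset_induct')
    case empty
    then show ?case using in_cube by (simp add: reachable_AD_refl)
  next
    case (insert i B)
    let ?y = "override_on x (f x) B"
    have "x \<rightarrow>\<^sup>*\<^bsub>AD m f\<^esub> ?y" by (fact insert.IH)
    also have "?y \<rightarrow>\<^sup>*\<^bsub>AD m f\<^esub> ?y(i := f ?y i)"
      using insert.hyps subset by (intro reachable_AD_fun_upd reachable_AD_in_cube[OF insert.IH]) auto
    also have "f ?y i = f x i"
      using insert.hyps by (intro no_influence) (auto simp: override_on_def)
    finally show ?case
      by (simp add: override_on_insert)
  qed
qed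

definition independent_set :: "'a pair_pre_digraph \<Rightarrow> 'a set \<Rightarrow> bool" where
  "independent_set G I \<longleftrightarrow> (\<forall>v\<in>I. neighbours G v \<inter> I = {})"

definition kernel_on :: "'a pair_pre_digraph \<Rightarrow> 'a set \<Rightarrow> 'a set \<Rightarrow> bool" where
  "kernel_on G V K \<longleftrightarrow> K \<subseteq> V \<and> (\<forall>v\<in>V. v \<in> K \<longleftrightarrow> neighbours G v \<inter> K = {})"

lemma kernel_on_imp_subset: "kernel_on G V K \<Longrightarrow> K \<subseteq> V"
  by (simp add: kernel_on_def)

lemma kernel_on_imp_independent_set: "kernel_on G V K \<Longrightarrow> independent_set G K"
  by (auto simp: kernel_on_def independent_set_def)

lemma (in pair_bidirected_digraph) independent_set_extends_to_kernel_on: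
  assumes "finite V" and "I \<subseteq> V" and "independent_set G I"
  obtains K where "I \<subseteq> K" and "kernel_on G V K"
proof -
  let ?candidates = "{J. J \<subseteq> V \<and> independent_set G J}"
  have "finite ?candidates" and "I \<in> ?candidates"
    using assms by simp_all
  from finite_has_maximal2[OF this] obtain K
    where "I \<subseteq> K" and "K \<subseteq> V" and independent: "independent_set G K"
      and maximal: "\<forall>J\<in>?candidates. K \<subseteq> J \<longrightarrow> K = J"
    by blast
  have "v \<in> K" if "v \<in> V" and "neighbours G v \<inter> K = {}" for v
  proof -
    have "v \<notin> neighbours G v" and "\<And>u. v \<in> neighbours G u \<Longrightarrow> u \<in> neighbours G v"
      using no_loops' arcs_symmetric by (auto simp: neighbours_def)
    then have "independent_set G (insert v K)"
      using independent that(2) by (auto simp: independent_set_def)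
    then show ?thesis
      using maximal \<open>K \<subseteq> V\<close> \<open>v \<in> V\<close> by blast
  qed
  then have "kernel_on G V K"
    using \<open>K \<subseteq> V\<close> independent by (auto simp: kernel_on_def independent_set_def)
  with \<open>I \<subseteq> K\<close> show thesis by (rule that)
qed

definition delta_state :: "nat \<Rightarrow> nat set \<Rightarrow> nat \<Rightarrow> bool" where
  "delta_state L D = (\<lambda>k\<in>{1..2 * L}. if k \<le> L then k \<notin> D else k - L \<in> D)"

lemma delta_state_in_cube: "delta_state L D \<in> cube (2 * L)"
  by (simp add: delta_state_def cube_def)

lemma delta_state_apply:
  assumes "i \<in> {1..L}"
  shows "delta_state L D i \<longleftrightarrow> i \<notin> D" and "delta_state L D (i + L) \<longleftrightarrow> i \<in> D"
  using assms by (auto simp: delta_state_def)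

locale cell_digraph = pair_wf_digraph G for G :: "nat pair_pre_digraph" +
  fixes L :: nat
  assumes pverts_eq: "pverts G = {1..L}"
begin

abbreviation dynamics :: "(nat \<Rightarrow> bool) pair_pre_digraph" where
  "dynamics \<equiv> AD (2 * L) (delta_notch L G)"

lemma neighbours_subset: "neighbours G i \<subseteq> {1..L}"
  using pverts_eq by (auto simp: neighbours_def dest: in_arcsD2)

lemma delta_notch_delta_state:
  assumes "i \<in> {1..L}"
  shows "delta_notch L G (delta_state L D) i \<longleftrightarrow> neighbours G i \<inter> D \<noteq> {}"
  using assms neighbours_subset[of i] by (auto simp: delta_notch_def delta_state_apply subset_iff)

lemma delta_state_kernel_fixed:
  assumes "kernel_on G {1..L} K"
  shows "delta_notch L G (delta_state L K) = delta_state L K"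
proof
  fix k
  consider "k \<in> {1..L}" | "k \<in> {1..2 * L}" "L < k" | "k \<notin> {1..2 * L}"
    by force
  then show "delta_notch L G (delta_state L K) k = delta_state L K k"
  proof cases
    assume "k \<in> {1..L}"
    then show ?thesis
      using assms by (simp add: delta_notch_delta_state delta_state_apply kernel_on_def)
  qed (auto simp: delta_notch_def delta_state_def)
qed

lemma reachable_delta_state:
  assumes "x \<in> cube (2 * L)"
  shows "x \<rightarrow>\<^sup>*\<^bsub>dynamics\<^esub> delta_state L {i \<in> {1..L}. \<not> x i}"
proof -
  let ?Deltas = "{L + 1..2 * L}"
  have "x \<rightarrow>\<^sup>*\<^bsub>dynamics\<^esub> override_on x (delta_notch L G x) ?Deltas"
    using assms by (rule reachable_AD_override_on) (auto simp: delta_notch_def)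
  also have "override_on x (delta_notch L G x) ?Deltas = delta_state L {i \<in> {1..L}. \<not> x i}"
    using assms
    by (auto simp: override_on_def delta_notch_def delta_state_def cube_def PiE_def
        extensional_def fun_eq_iff)
  finally show ?thesis .
qed

lemma delta_state_reachable_if_unstable:
  assumes subsets: "D \<subseteq> {1..L}" "E \<subseteq> {1..L}"
    and unstable: "\<And>i. i \<in> sym_diff D E \<Longrightarrow> i \<in> D \<longleftrightarrow> neighbours G i \<inter> D \<noteq> {}"
  shows "delta_state L D \<rightarrow>\<^sup>*\<^bsub>dynamics\<^esub> delta_state L E"
proof -
  let ?s = "delta_state L D"
  let ?t = "override_on ?s (delta_notch L G ?s) (sym_diff D E)"
  have "?s \<rightarrow>\<^sup>*\<^bsub>dynamics\<^esub> ?t"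
  proof (rule reachable_AD_override_on)
    show "?s \<in> cube (2 * L)" by (rule delta_state_in_cube)
    show "sym_diff D E \<subseteq> {1..2 * L}" using subsets by auto
  next
    fix y i
    assume changed: "i \<in> sym_diff D E" and agree: "\<And>k. k \<notin> sym_diff D E \<Longrightarrow> y k = ?s k"
    have "y (j + L) = ?s (j + L)" if "j \<in> neighbours G i" for j
      using that neighbours_subset[of i] subsets by (intro agree) fastforce
    then show "delta_notch L G y i = delta_notch L G ?s i"
      using changed subsets by (auto simp: delta_notch_def)
  qed
  also have "?t \<rightarrow>\<^sup>*\<^bsub>dynamics\<^esub> delta_state L {i \<in> {1..L}. \<not> ?t i}"
    using calculation by (intro reachable_delta_state reachable_AD_in_cube)
  also have "{i \<in> {1..L}. \<not> ?t i} = E"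
  proof -
    have "\<not> ?t i \<longleftrightarrow> i \<in> E" if "i \<in> {1..L}" for i
      using that unstable[of i]
      by (auto simp: override_on_def delta_notch_delta_state delta_state_apply)
    then show ?thesis using subsets(2) by blast
  qed
  finally show ?thesis .
qed

lemma delta_state_reachable_kernel_on:
  assumes kernel: "kernel_on G D I" and subset: "D \<subseteq> {1..L}"
  shows "delta_state L D \<rightarrow>\<^sup>*\<^bsub>dynamics\<^esub> delta_state L I"
proof (rule delta_state_reachable_if_unstable)
  have "I \<subseteq> D"
    using kernel by (rule kernel_on_imp_subset)
  then show "I \<subseteq> {1..L}"
    using subset by blast
  fix i
  assume "i \<in> sym_diff D I"
  then have "i \<in> D" and "i \<notin> I"
    using \<open>I \<subseteq> D\<close> by auto
  then have "neighbours G i \<inter> I \<noteq> {}"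
    using kernel by (simp add: kernel_on_def)
  then show "i \<in> D \<longleftrightarrow> neighbours G i \<inter> D \<noteq> {}"
    using \<open>i \<in> D\<close> \<open>I \<subseteq> D\<close> by blast
qed (fact subset)

lemma delta_state_reachable_independent_superset:
  assumes independent: "independent_set G K" and "I \<subseteq> K" and "K \<subseteq> {1..L}"
  shows "delta_state L I \<rightarrow>\<^sup>*\<^bsub>dynamics\<^esub> delta_state L K"
proof (rule delta_state_reachable_if_unstable)
  fix i
  assume "i \<in> sym_diff I K"
  then have "i \<in> K" and "i \<notin> I"
    using \<open>I \<subseteq> K\<close> by auto
  then have "neighbours G i \<inter> I = {}"
    using independent \<open>I \<subseteq> K\<close> \<open>i \<in> K\<close> by (auto simp: independent_set_def)
  then show "i \<in> I \<longleftrightarrow> neighbours G i \<inter> I \<noteq> {}"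
    using \<open>i \<notin> I\<close> by blast
qed (use assms in auto)

end

theorem theorem4:
  fixes L :: nat and G :: "nat pair_pre_digraph" and x :: "nat \<Rightarrow> bool"
  assumes "1 \<le> L"
    and "pair_graph G" and "pverts G = {1..L}" and "connected (with_proj G)"
    and "x \<in> cube (2 * L)" and "delta_notch L G x \<noteq> x"
  shows "\<exists>y p. y \<in> cube (2 * L) \<and> delta_notch L G y = y \<and>
    pre_digraph.apath (with_proj (AD (2 * L) (delta_notch L G))) x p y"
proof -
  interpret pair_graph G by fact
  interpret cell_digraph G L by unfold_locales fact
  let ?D = "{i \<in> {1..L}. \<not> x i}"
  have "independent_set G {}"
    by (simp add: independent_set_def)
  then obtain I where kernel_I: "kernel_on G ?D I"
    using independent_set_extends_to_kernel_on[of ?D "{}"] by auto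
  then have "I \<subseteq> {1..L}"
    using kernel_on_imp_subset by blast
  then obtain K where "I \<subseteq> K" and kernel_K: "kernel_on G {1..L} K"
    using independent_set_extends_to_kernel_on kernel_on_imp_independent_set[OF kernel_I] by blast
  have "x \<rightarrow>\<^sup>*\<^bsub>dynamics\<^esub> delta_state L ?D"
    using \<open>x \<in> cube (2 * L)\<close> by (rule reachable_delta_state)
  also have "delta_state L ?D \<rightarrow>\<^sup>*\<^bsub>dynamics\<^esub> delta_state L I"
    using kernel_I by (rule delta_state_reachable_kernel_on) blast
  also have "delta_state L I \<rightarrow>\<^sup>*\<^bsub>dynamics\<^esub> delta_state L K"
    using kernel_on_imp_independent_set[OF kernel_K] \<open>I \<subseteq> K\<close> kernel_on_imp_subset[OF kernel_K]
    by (rule delta_state_reachable_independent_superset)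
  finally show ?thesis
    using delta_state_in_cube delta_state_kernel_fixed[OF kernel_K]
    by (auto simp: wf_digraph.reachable_apath[OF wf_digraph_AD])
qed

end
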